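(* Consider the X-REGO algorithm (described in the context) with $0<\lambda<\epsilon$. Suppose that: (Success-Solv) there is $\rho_{lb}>0$ such that for all $k\ge1$ there exists $\rho^k\in[\rho_{lb},1]$ with $\mathbb{P}[S^k=1\mid\mathcal{F}^{k-1/2}]=\mathbb{E}[S^k\mid\mathcal{F}^{k-1/2}]\ge\rho^k$; (Success-Emb) there is $\tau_{lb}>0$ such that for all $k\ge1$ there exists $\tau^k\in[\tau_{lb},1]$ with $\mathbb{P}[R^k=1\mid\mathcal{F}^{k-1}]=\mathbb{E}[R^k\mid\mathcal{F}^{k-1}]\ge\tau^k$. Then $$\lim_{k\to\infty}\mathbb{P}[x^k_{opt}\in G_\epsilon]=\lim_{k\to\infty}\mathbb{P}[f(x^k_{opt})\le f^*+\epsilon]=1.$$ Furthermore, for any $\xi\in(0,1)$, $$\mathbb{P}[x^k_{opt}\in G_\epsilon]=\mathbb{P}[f(x^k_{opt})\le f^*+\epsilon]\ge\xi\quad\text{for all } k\ge K_\xi,\qquad K_\xi:=\left\lceil\frac{|\log(1-\xi)|}{\tau_{lb}\,\rho_{lb}}\right\rceil.$$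
   Context: Problem: $f^*:=\min_{x\in\mathcal{X}}f(x)$ (attained), where $\mathcal{X}\subseteq\mathbb{R}^D$ has non-empty interior (possibly unbounded) and $f:\mathcal{X}\to\mathbb{R}$ is Lipschitz continuous. $G_\epsilon:=\{x\in\mathcal{X}: f(x)\le f^*+\epsilon\}$. X-REGO as a stochastic process: $p^0$ is a random vector with values in $\mathcal{X}$. For $k\ge1$: a deterministic dimension $d^k\in\{1,\dots,D-1\}$ is given; $A^k$ is a $D\times d^k$ Gaussian matrix (independent standard normal entries); the random reduced problem is $$(\mathrm{RP}\mathcal{X}^k)\qquad f^k_{min}=\min_{y\in\mathbb{R}^{d^k}} f(A^ky+p^{k-1})\ \text{ subject to } A^ky+p^{k-1}\in\mathcal{X};$$ a (deterministic or stochastic) solver returns a random vector $y^k\in\mathbb{R}^{d^k}$ feasible for it; one sets $x^k:=A^ky^k+p^{k-1}\in\mathcal{X}$; and a random vector $p^k$ with values in $\mathcal{X}$ is chosen (deterministically or randomly, possibly depending on the past). The best point after $k$ embeddings is $x^k_{opt}:=\arg\min\{f(x^1),\dots,f(x^k)\}$, i.e. a point among $x^1,\dots,x^k$ with smallest value of $f$. Define $R^k:=\mathbf{1}\{f^k_{min}\le f^*+\epsilon-\lambda\}$ (the $k$th reduced problem is $(\epsilon-\lambda)$-successful) and $S^k:=\mathbf{1}\{f(A^ky^k+p^{k-1})\le f^k_{min}+\lambda\}$ (it is solved to accuracy $\lambda$). $\sigma$-algebras: $\mathcal{F}^0=\sigma(p^0)$, $\mathcal{F}^k=\sigma(A^1,\dots,A^k,y^1,\dots,y^k,p^0,\dots,p^k)$,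 and $\mathcal{F}^{k-1/2}=\sigma(A^1,\dots,A^k,y^1,\dots,y^{k-1},p^0,\dots,p^{k-1})$. Then $\mathcal F^{k-1}\subseteq\mathcal F^{k-1/2}\subseteq\mathcal F^k$; $x^k,R^k,S^k$ are $\mathcal{F}^k$-measurable and $R^k$ is $\mathcal{F}^{k-1/2}$-measurable. The numbers $\rho^k,\tau^k,\rho_{lb},\tau_{lb}$ are deterministic. *)

theory Defs
  imports "HOL-Probability.Probability"
begin

text \<open>
  The dimension of the reduced problem varies with the iteration, so a \<open>D \<times> d\<close> matrix is a function
  \<open>'n \<Rightarrow> nat \<Rightarrow> real\<close> (with \<open>D = CARD('n)\<close>) and a vector of \<open>d\<close> coordinates a function
  \<open>nat \<Rightarrow> real\<close>; in both cases only the indices \<open>l < d\<close> are ever used.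
\<close>

definition mat_vec :: "nat \<Rightarrow> ('n \<Rightarrow> nat \<Rightarrow> real) \<Rightarrow> (nat \<Rightarrow> real) \<Rightarrow> real ^ 'n" where
  "mat_vec d B v = (\<chi> i. \<Sum>l<d. B i l * v l)"

definition fstar :: "'a set \<Rightarrow> ('a \<Rightarrow> real) \<Rightarrow> real" where
  "fstar X f = (INF x\<in>X. f x)"

definition G_set :: "'a set \<Rightarrow> ('a \<Rightarrow> real) \<Rightarrow> real \<Rightarrow> 'a set" where
  "G_set X f eps = {x \<in> X. f x \<le> fstar X f + eps}"

text \<open>
  The optimal value of the reduced problem. It is an infimum because \<open>X\<close> need not be closed; it is
  the minimum whenever that is attained. For \<open>q \<in> X\<close> and \<open>f\<close> bounded below on \<open>X\<close> the infimum
  ranges over a nonempty set that is bounded below.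
\<close>

definition fmin :: "(real ^ 'n) set \<Rightarrow> (real ^ 'n \<Rightarrow> real) \<Rightarrow> nat \<Rightarrow> ('n \<Rightarrow> nat \<Rightarrow> real) \<Rightarrow> real ^ 'n \<Rightarrow> real" where
  "fmin X f d B q = (INF v\<in>{v. mat_vec d B v + q \<in> X}. f (mat_vec d B v + q))"

text \<open>
  In what follows \<open>A k\<close>, \<open>y k\<close> (for \<open>k \<ge> 1\<close>) and \<open>p k\<close> (for \<open>k \<ge> 0\<close>) are random elements on a
  sample space with points \<open>w\<close>; the objects indexed by \<open>k\<close> are meaningful for \<open>k \<ge> 1\<close> only.
\<close>

definition iterate ::
  "(nat \<Rightarrow> nat) \<Rightarrow> (nat \<Rightarrow> 'w \<Rightarrow> 'n \<Rightarrow> nat \<Rightarrow> real) \<Rightarrow> (nat \<Rightarrow> 'w \<Rightarrow> nat \<Rightarrow> real) \<Rightarrow>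
   (nat \<Rightarrow> 'w \<Rightarrow> real ^ 'n) \<Rightarrow> nat \<Rightarrow> 'w \<Rightarrow> real ^ 'n" where
  "iterate d A y p k w = mat_vec (d k) (A k w) (y k w) + p (k - 1) w"

definition R_ind ::
  "(real ^ 'n) set \<Rightarrow> (real ^ 'n \<Rightarrow> real) \<Rightarrow> real \<Rightarrow> real \<Rightarrow> (nat \<Rightarrow> nat) \<Rightarrow>
   (nat \<Rightarrow> 'w \<Rightarrow> 'n \<Rightarrow> nat \<Rightarrow> real) \<Rightarrow> (nat \<Rightarrow> 'w \<Rightarrow> real ^ 'n) \<Rightarrow> nat \<Rightarrow> 'w \<Rightarrow> real" where
  "R_ind X f eps lam d A p k w =
     of_bool (fmin X f (d k) (A k w) (p (k - 1) w) \<le> fstar X f + eps - lam)"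

definition S_ind ::
  "(real ^ 'n) set \<Rightarrow> (real ^ 'n \<Rightarrow> real) \<Rightarrow> real \<Rightarrow> (nat \<Rightarrow> nat) \<Rightarrow>
   (nat \<Rightarrow> 'w \<Rightarrow> 'n \<Rightarrow> nat \<Rightarrow> real) \<Rightarrow> (nat \<Rightarrow> 'w \<Rightarrow> nat \<Rightarrow> real) \<Rightarrow>
   (nat \<Rightarrow> 'w \<Rightarrow> real ^ 'n) \<Rightarrow> nat \<Rightarrow> 'w \<Rightarrow> real" where
  "S_ind X f lam d A y p k w =
     of_bool (f (iterate d A y p k w) \<le> fmin X f (d k) (A k w) (p (k - 1) w) + lam)"

text \<open>
  The sigma-algebra generated by \<open>A 1, \<dots>, A a\<close>, \<open>y 1, \<dots>, y b\<close>, \<open>p 0, \<dots>, p c\<close>. Each matrix or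
  coordinate vector contributes through its entries, which generate the same sigma-algebra as the
  random element itself.
\<close>

definition history ::
  "'w set \<Rightarrow> (nat \<Rightarrow> nat) \<Rightarrow> (nat \<Rightarrow> 'w \<Rightarrow> 'n \<Rightarrow> nat \<Rightarrow> real) \<Rightarrow> (nat \<Rightarrow> 'w \<Rightarrow> nat \<Rightarrow> real) \<Rightarrow>
   (nat \<Rightarrow> 'w \<Rightarrow> real ^ 'n) \<Rightarrow> nat \<Rightarrow> nat \<Rightarrow> nat \<Rightarrow> 'w measure" where
  "history \<Omega> d A y p a b c = sigma \<Omega>
     ({(\<lambda>w. A j w i l) -` B \<inter> \<Omega> | j i l B. j \<in> {1..a} \<and> l < d j \<and> B \<in> sets borel} \<union>
      {(\<lambda>w. y j w l) -` B \<inter> \<Omega> | j l B. j \<in> {1..b} \<and> l < d j \<and> B \<in> sets borel} \<union>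
      {p j -` B \<inter> \<Omega> | j B. j \<in> {0..c} \<and> B \<in> sets borel})"

definition Filt ::
  "'w set \<Rightarrow> (nat \<Rightarrow> nat) \<Rightarrow> (nat \<Rightarrow> 'w \<Rightarrow> 'n \<Rightarrow> nat \<Rightarrow> real) \<Rightarrow> (nat \<Rightarrow> 'w \<Rightarrow> nat \<Rightarrow> real) \<Rightarrow>
   (nat \<Rightarrow> 'w \<Rightarrow> real ^ 'n) \<Rightarrow> nat \<Rightarrow> 'w measure" where
  "Filt \<Omega> d A y p k = history \<Omega> d A y p k k k"

text \<open>\<open>Filt_half \<Omega> d A y p k\<close> is the sigma-algebra with superscript \<open>k - 1/2\<close>.\<close>

definition Filt_half ::
  "'w set \<Rightarrow> (nat \<Rightarrow> nat) \<Rightarrow> (nat \<Rightarrow> 'w \<Rightarrow> 'n \<Rightarrow> nat \<Rightarrow> real) \<Rightarrow> (nat \<Rightarrow> 'w \<Rightarrow> nat \<Rightarrow> real) \<Rightarrow>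
   (nat \<Rightarrow> 'w \<Rightarrow> real ^ 'n) \<Rightarrow> nat \<Rightarrow> 'w measure" where
  "Filt_half \<Omega> d A y p k = history \<Omega> d A y p k (k - 1) (k - 1)"

text \<open>
  \<open>R_measurable\<close> and \<open>S_measurable\<close> are standing assumptions on the process: for an arbitrary set
  \<open>X\<close> (not assumed Borel) they do not follow from the measurability of \<open>A\<close>, \<open>y\<close>, \<open>p\<close>.
  Independence is required of the entries within each matrix; nothing is said about the joint law
  of the matrices of different iterations and the points \<open>p\<close>.
\<close>

locale x_rego = prob_space M
  for M :: "'w measure" +
  fixes X :: "(real ^ 'n) set" and f :: "real ^ 'n \<Rightarrow> real"
    and eps lam :: real
    and d :: "nat \<Rightarrow> nat"
    and A :: "nat \<Rightarrow> 'w \<Rightarrow> 'n \<Rightarrow> nat \<Rightarrow> real"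
    and y :: "nat \<Rightarrow> 'w \<Rightarrow> nat \<Rightarrow> real"
    and p :: "nat \<Rightarrow> 'w \<Rightarrow> real ^ 'n"
  assumes interior_nonempty: "interior X \<noteq> {}"
    and lipschitz: "\<exists>L. L-lipschitz_on X f"
    and min_attained: "\<exists>x\<in>X. \<forall>z\<in>X. f x \<le> f z"
    and dimension: "\<And>k. k \<ge> 1 \<Longrightarrow> d k \<in> {1..CARD('n) - 1}"
    and A_indep: "\<And>k. k \<ge> 1 \<Longrightarrow>
      indep_vars (\<lambda>_. borel) (\<lambda>(i, l) w. A k w i l) (UNIV \<times> {..<d k})"
    and A_normal: "\<And>k i l. k \<ge> 1 \<Longrightarrow> l < d k \<Longrightarrow>
      distributed M lborel (\<lambda>w. A k w i l) (\<lambda>t. ennreal (std_normal_density t))"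
    and y_measurable: "\<And>k l. k \<ge> 1 \<Longrightarrow> l < d k \<Longrightarrow> (\<lambda>w. y k w l) \<in> borel_measurable M"
    and p_measurable: "\<And>k. p k \<in> borel_measurable M"
    and p_in: "\<And>k w. w \<in> space M \<Longrightarrow> p k w \<in> X"
    and feasible: "\<And>k w. k \<ge> 1 \<Longrightarrow> w \<in> space M \<Longrightarrow> iterate d A y p k w \<in> X"
    and R_measurable: "\<And>k. k \<ge> 1 \<Longrightarrow>
      R_ind X f eps lam d A p k \<in> borel_measurable (Filt_half (space M) d A y p k)"
    and S_measurable: "\<And>k. k \<ge> 1 \<Longrightarrow>
      S_ind X f lam d A y p k \<in> borel_measurable (Filt (space M) d A y p k)"

definition K_xi :: "real \<Rightarrow> real \<Rightarrow> real \<Rightarrow> nat" where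
  "K_xi tau_lb rho_lb xi = nat \<lceil>\<bar>ln (1 - xi)\<bar> / (tau_lb * rho_lb)\<rceil>"

end

theory Submission
  imports Defs
begin

text \<open>
  Let \<open>N k\<close> be the product of \<open>1 - R j * S j\<close> over \<open>1 \<le> j \<le> k\<close>. Conditioning first on the half-step
  sigma-algebra and then on the previous full-step one gives
  \<open>E (N (k - 1) * R k * S k) \<ge> \<rho> * E (N (k - 1) * R k) \<ge> \<rho> * \<tau> * E (N (k - 1))\<close>, hence
  \<open>E (N k) \<le> (1 - \<tau> * \<rho>) ^ k \<le> exp (- k * \<tau> * \<rho>)\<close>. If \<open>N k = 0\<close>, then some reduced problem was both
  \<open>(eps - lam)\<close>-successful and solved to accuracy \<open>lam\<close>, so \<open>xopt k\<close> is \<open>eps\<close>-optimal.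
\<close>

text \<open>Since \<open>g\<close> is known to \<open>F\<close>, it can be pulled out:
  \<open>g * h\<close> and \<open>g * real_cond_exp M F h\<close> have the same expectation, and
  \<open>g\<close> being nonnegative keeps the almost sure bound \<open>c\<close>. The upper bounds
  by 1 serve integrability.\<close>

lemma (in prob_space) integral_mult_ge_cond_exp:
  fixes g h :: "'a \<Rightarrow> real"
  assumes sub: "subalgebra M F"
    and g: "g \<in> borel_measurable F" "\<And>w. 0 \<le> g w" "\<And>w. g w \<le> 1"
    and h: "h \<in> borel_measurable M" "\<And>w. 0 \<le> h w" "\<And>w. h w \<le> 1"
    and ge: "AE w in M. c \<le> real_cond_exp M F h w"
  shows "c * expectation g \<le> expectation (\<lambda>w. g w * h w)"
proof -
  interpret finite_measure_subalgebra M F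
    by unfold_locales (fact sub)
  note [measurable] = measurable_from_subalg[OF sub g(1)] h(1)
  have int_g: "integrable M g"
    by (rule integrable_const_bound[where B = 1]) (use g in auto)
  have int: "integrable M (\<lambda>w. g w * h w)"
    by (rule integrable_const_bound[where B = 1]) (use g h in \<open>auto simp: abs_mult intro!: AE_I2 mult_le_one\<close>)
  have "c * expectation g = expectation (\<lambda>w. g w * c)"
    by simp
  also have "\<dots> \<le> expectation (\<lambda>w. g w * real_cond_exp M F h w)"
  proof (rule integral_mono_AE)
    show "integrable M (\<lambda>w. g w * real_cond_exp M F h w)"
      by (rule real_cond_exp_intg(1)[OF int g(1) h(1)])
    show "AE w in M. g w * c \<le> g w * real_cond_exp M F h w"
      using ge by eventually_elim (simp add: g mult_left_mono)
  qed (simp add: int_g)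
  also have "\<dots> = expectation (\<lambda>w. g w * h w)"
    by (rule real_cond_exp_intg(2)[OF int g(1) h(1)])
  finally show ?thesis .
qed

lemma prod_one_minus_bounds:
  fixes a b :: "'i \<Rightarrow> real"
  assumes "\<And>j. j \<in> J \<Longrightarrow> 0 \<le> a j \<and> a j \<le> 1" "\<And>j. j \<in> J \<Longrightarrow> 0 \<le> b j \<and> b j \<le> 1"
  shows "0 \<le> (\<Prod>j\<in>J. 1 - a j * b j)" "(\<Prod>j\<in>J. 1 - a j * b j) \<le> 1"
  using assms by (auto intro!: prod_nonneg prod_le_1 mult_le_one)

text \<open>The two-stage conditioning for abstract filtrations, by induction on \<open>k\<close>:
  \<open>F\<close> stands for full steps, \<open>H\<close> for half steps, interlaced as
  \<open>F k\<close>, \<open>H (Suc k)\<close>, \<open>F (Suc k)\<close>. Measurability is asked at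
  successors only, because the process has no \<open>R 0\<close> or \<open>S 0\<close>.\<close>

lemma (in prob_space) expectation_prod_failure_le:
  fixes R S :: "nat \<Rightarrow> 'a \<Rightarrow> real"
  assumes sub: "\<And>k. subalgebra M (F k)"
    and sub_half: "\<And>k. subalgebra M (H k)"
    and mono: "\<And>i k. i \<le> k \<Longrightarrow> subalgebra (F k) (F i)"
    and F_H: "\<And>k. subalgebra (H (Suc k)) (F k)"
    and H_F: "\<And>k. subalgebra (F k) (H k)"
    and R: "\<And>k. R (Suc k) \<in> borel_measurable (H (Suc k))" "\<And>k w. 0 \<le> R k w \<and> R k w \<le> 1"
    and S: "\<And>k. S (Suc k) \<in> borel_measurable (F (Suc k))" "\<And>k w. 0 \<le> S k w \<and> S k w \<le> 1"
    and rates: "0 \<le> \<rho>" "\<tau> * \<rho> \<le> 1"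
    and ge_S: "\<And>k. AE w in M. \<rho> \<le> real_cond_exp M (H (Suc k)) (S (Suc k)) w"
    and ge_R: "\<And>k. AE w in M. \<tau> \<le> real_cond_exp M (F k) (R (Suc k)) w"
  shows "expectation (\<lambda>w. \<Prod>j=1..k. 1 - R j w * S j w) \<le> (1 - \<tau> * \<rho>) ^ k"
proof (induction k)
  case 0
  then show ?case by (simp add: prob_space)
next
  case (Suc k)
  let ?N = "\<lambda>k w. \<Prod>j=1..k. 1 - R j w * S j w"
  note bounds = prod_one_minus_bounds[of "{1..k}" "\<lambda>j. R j w" "\<lambda>j. S j w" for w, OF R(2) S(2)]
  have N_F: "?N k \<in> borel_measurable (F k)"
  proof (intro borel_measurable_prod borel_measurable_diff borel_measurable_times borel_measurable_const)
    fix j assume "j \<in> {1..k}"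
    then obtain i where j: "j = Suc i" "j \<le> k"
      by (cases j) auto
    show "R j \<in> borel_measurable (F k)" "S j \<in> borel_measurable (F k)"
      unfolding j(1) using R(1)[of i] S(1)[of i] H_F[of j] mono[OF j(2)] j(1)
      by (metis measurable_from_subalg)+
  qed
  \<comment> \<open>\<open>R (Suc k)\<close> is known at the half step, so it may join
    \<open>?N k\<close> as the factor pulled out when \<open>S (Suc k)\<close> is conditioned on
    \<open>H (Suc k)\<close>.\<close>
  have NR_H: "(\<lambda>w. ?N k w * R (Suc k) w) \<in> borel_measurable (H (Suc k))"
    by (intro borel_measurable_times R measurable_from_subalg[OF F_H N_F])
  have R_M: "R (Suc k) \<in> borel_measurable M" and S_M: "S (Suc k) \<in> borel_measurable M"
    by (rule measurable_from_subalg[OF sub_half R(1)] measurable_from_subalg[OF sub S(1)])+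
  note N_M = measurable_from_subalg[OF sub N_F]
  have "\<rho> * (\<tau> * expectation (?N k)) \<le> \<rho> * expectation (\<lambda>w. ?N k w * R (Suc k) w)"
    using integral_mult_ge_cond_exp[OF sub N_F bounds R_M _ _ ge_R] R(2) rates(1)
    by (simp add: mult_left_mono)
  also have "\<dots> \<le> expectation (\<lambda>w. (?N k w * R (Suc k) w) * S (Suc k) w)"
    by (rule integral_mult_ge_cond_exp[OF sub_half NR_H _ _ S_M _ _ ge_S])
      (use R(2) S(2) bounds in \<open>auto intro: mult_le_one\<close>)
  finally have step: "\<tau> * \<rho> * expectation (?N k) \<le> expectation (\<lambda>w. ?N k w * R (Suc k) w * S (Suc k) w)"
    by (simp add: mult_ac)
  have int: "integrable M (?N k)"
    by (rule integrable_const_bound[where B = 1]) (use bounds N_M in auto)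
  have int': "integrable M (\<lambda>w. ?N k w * R (Suc k) w * S (Suc k) w)"
    by (rule integrable_const_bound[where B = 1])
      (use R(2) S(2) bounds R_M S_M N_M in
        \<open>auto simp del: One_nat_def simp: abs_mult intro!: AE_I2 mult_le_one borel_measurable_times\<close>)
  have "expectation (?N (Suc k)) = expectation (\<lambda>w. ?N k w - ?N k w * R (Suc k) w * S (Suc k) w)"
    by (intro Bochner_Integration.integral_cong) (auto simp: algebra_simps)
  also have "\<dots> = expectation (?N k) - expectation (\<lambda>w. ?N k w * R (Suc k) w * S (Suc k) w)"
    using int int' by (rule Bochner_Integration.integral_diff)
  also have "\<dots> \<le> (1 - \<tau> * \<rho>) * expectation (?N k)"
    using step by (simp add: algebra_simps)
  \<comment> \<open>The induction hypothesis may be multiplied by \<open>1 - \<tau> * \<rho>\<close>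
    because \<open>rates\<close> makes this factor nonnegative.\<close>
  also have "\<dots> \<le> (1 - \<tau> * \<rho>) * (1 - \<tau> * \<rho>) ^ k"
    using Suc rates(2) by (intro mult_left_mono) auto
  finally show ?case by simp
qed

text \<open>Larger index ranges give more generators. All inclusions among \<open>Filt\<close> and
  \<open>Filt_half\<close> are instances.\<close>

lemma subalgebra_history_history:
  assumes "a \<le> a'" "b \<le> b'" "c \<le> c'"
  shows "subalgebra (history \<Omega> d A y p a' b' c') (history \<Omega> d A y p a b c)"
  unfolding subalgebra_def history_def
proof (intro conjI)
  show "sets (sigma \<Omega>
     ({(\<lambda>w. A j w i l) -` B \<inter> \<Omega> | j i l B. j \<in> {1..a} \<and> l < d j \<and> B \<in> sets borel} \<union>
      {(\<lambda>w. y j w l) -` B \<inter> \<Omega> | j l B. j \<in> {1..b} \<and> l < d j \<and> B \<in> sets borel} \<union>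
      {p j -` B \<inter> \<Omega> | j B. j \<in> {0..c} \<and> B \<in> sets borel}))
    \<subseteq> sets (sigma \<Omega>
     ({(\<lambda>w. A j w i l) -` B \<inter> \<Omega> | j i l B. j \<in> {1..a'} \<and> l < d j \<and> B \<in> sets borel} \<union>
      {(\<lambda>w. y j w l) -` B \<inter> \<Omega> | j l B. j \<in> {1..b'} \<and> l < d j \<and> B \<in> sets borel} \<union>
      {p j -` B \<inter> \<Omega> | j B. j \<in> {0..c'} \<and> B \<in> sets borel}))"
    (is "sets (sigma \<Omega> ?G) \<subseteq> sets (sigma \<Omega> ?G')")
  proof -
    have "{1..a} \<subseteq> {1..a'}" "{1..b} \<subseteq> {1..b'}" "{0..c} \<subseteq> {0..c'}"
      using assms by simp_all
    then have "?G \<subseteq> ?G'"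
      by (intro Un_mono; blast)
    moreover have "?G \<subseteq> Pow \<Omega>" "?G' \<subseteq> Pow \<Omega>"
      by (intro Un_least; blast)+
    ultimately show ?thesis
      by (simp only: sets_measure_of sigma_sets_mono')
  qed
qed (simp add: space_measure_of_conv)

text \<open>\<open>X\<close> need not be Borel: sublevel sets of \<open>f\<close> are only relatively closed, which suffices because
  \<open>x\<close> takes its values in \<open>X\<close>.\<close>

lemma sets_sublevel_continuous_on:
  fixes f :: "'b::topological_space \<Rightarrow> real"
  assumes "continuous_on X f" and x: "x \<in> borel_measurable M" and "\<And>w. w \<in> space M \<Longrightarrow> x w \<in> X"
  shows "{w \<in> space M. f (x w) \<le> c} \<in> sets M"
proof -
  obtain C where C: "closed C" "X \<inter> f -` {..c} = X \<inter> C"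
    using continuous_closedin_preimage[OF assms(1) closed_atMost] unfolding closedin_closed by blast
  then have "{w \<in> space M. f (x w) \<le> c} = x -` C \<inter> space M"
    using assms(3) by blast
  then show ?thesis
    using x C(1) by (simp add: measurable_sets)
qed

context x_rego
begin

lemma A_measurable:
  assumes "k \<ge> 1" "l < d k"
  shows "(\<lambda>w. A k w i l) \<in> borel_measurable M"
  using distributed_measurable[OF A_normal[OF assms]] by simp

lemma subalgebra_history: "subalgebra M (history (space M) d A y p a b c)"
  unfolding subalgebra_def history_def
proof (intro conjI)
  show "sets (sigma (space M)
     ({(\<lambda>w. A j w i l) -` B \<inter> space M | j i l B. j \<in> {1..a} \<and> l < d j \<and> B \<in> sets borel} \<union>
      {(\<lambda>w. y j w l) -` B \<inter> space M | j l B. j \<in> {1..b} \<and> l < d j \<and> B \<in> sets borel} \<union>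
      {p j -` B \<inter> space M | j B. j \<in> {0..c} \<and> B \<in> sets borel})) \<subseteq> sets M"
    (is "sets (sigma _ ?G) \<subseteq> _")
  proof -
    have "?G \<subseteq> sets M"
      using measurable_sets[OF A_measurable] measurable_sets[OF y_measurable]
        measurable_sets[OF p_measurable]
      by (intro Un_least; clarsimp)
    moreover have "?G \<subseteq> Pow (space M)"
      by (intro Un_least; blast)
    ultimately show ?thesis
      by (simp only: sets_measure_of sets.sigma_sets_subset)
  qed
qed (simp add: space_measure_of_conv)

lemma iterate_measurable:
  assumes "k \<ge> 1"
  shows "iterate d A y p k \<in> borel_measurable M"
proof -
  \<comment> \<open>Measurability of the vector is tested on its coordinates, which are finite sums
    of products of measurable entries.\<close>
  have "(\<lambda>w. mat_vec (d k) (A k w) (y k w) \<bullet> axis i 1) \<in> borel_measurable M" for i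
    unfolding mat_vec_def inner_axis using A_measurable[OF assms] y_measurable[OF assms]
    by (auto intro!: borel_measurable_sum borel_measurable_times)
  then have "(\<lambda>w. mat_vec (d k) (A k w) (y k w)) \<in> borel_measurable M"
    by (subst borel_measurable_euclidean_space) (auto simp: Basis_vec_def)
  then show ?thesis
    unfolding iterate_def using p_measurable by (rule borel_measurable_add)
qed

lemma iterate_sublevel_measurable:
  "k \<ge> 1 \<Longrightarrow> {w \<in> space M. f (iterate d A y p k w) \<le> c} \<in> sets M"
  using lipschitz feasible iterate_measurable
  by (blast intro: sets_sublevel_continuous_on lipschitz_on_continuous_on)

end

theorem theorem6p3:
  fixes M :: "'w measure"
    and X :: "(real ^ 'n) set" and f :: "real ^ 'n \<Rightarrow> real"
    and eps lam rho_lb tau_lb :: real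
    and d :: "nat \<Rightarrow> nat"
    and A :: "nat \<Rightarrow> 'w \<Rightarrow> 'n \<Rightarrow> nat \<Rightarrow> real"
    and y :: "nat \<Rightarrow> 'w \<Rightarrow> nat \<Rightarrow> real"
    and p xopt :: "nat \<Rightarrow> 'w \<Rightarrow> real ^ 'n"
  assumes "x_rego M X f eps lam d A y p"
    and "0 < lam" and "lam < eps"
    and xopt: "\<And>k w. k \<ge> 1 \<Longrightarrow> w \<in> space M \<Longrightarrow>
      is_arg_min f (\<lambda>z. z \<in> (\<lambda>j. iterate d A y p j w) ` {1..k}) (xopt k w)"
    and "rho_lb > 0"
    and success_solv: "\<forall>k\<ge>1. \<exists>rho\<in>{rho_lb..1}. AE w in M.
      real_cond_exp M (Filt_half (space M) d A y p k) (S_ind X f lam d A y p k) w \<ge> rho"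
    and "tau_lb > 0"
    and success_emb: "\<forall>k\<ge>1. \<exists>tau\<in>{tau_lb..1}. AE w in M.
      real_cond_exp M (Filt (space M) d A y p (k - 1)) (R_ind X f eps lam d A p k) w \<ge> tau"
  shows "((\<lambda>k. measure M {w \<in> space M. xopt k w \<in> G_set X f eps}) \<longlonglongrightarrow> 1) \<and>
    ((\<lambda>k. measure M {w \<in> space M. f (xopt k w) \<le> fstar X f + eps}) \<longlonglongrightarrow> 1) \<and>
    (\<forall>k\<ge>1. measure M {w \<in> space M. xopt k w \<in> G_set X f eps} =
      measure M {w \<in> space M. f (xopt k w) \<le> fstar X f + eps}) \<and>
    (\<forall>xi\<in>{0<..<1}. \<forall>k\<ge>K_xi tau_lb rho_lb xi.
      measure M {w \<in> space M. xopt k w \<in> G_set X f eps} \<ge> xi \<and>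
      measure M {w \<in> space M. f (xopt k w) \<le> fstar X f + eps} \<ge> xi)"
proof -
  interpret x_rego M X f eps lam d A y p by fact
  let ?x = "iterate d A y p"
  let ?R = "R_ind X f eps lam d A p" and ?S = "S_ind X f lam d A y p"
  let ?P = "\<lambda>k. measure M {w \<in> space M. f (xopt k w) \<le> fstar X f + eps}"
  let ?Q = "\<lambda>k. measure M {w \<in> space M. xopt k w \<in> G_set X f eps}"
  define q where "q = tau_lb * rho_lb"
  \<comment> \<open>The hypotheses at \<open>k = 1\<close> provide elements of
    \<open>{tau_lb..1}\<close> and \<open>{rho_lb..1}\<close>, so these intervals are
    nonempty.\<close>
  have "tau_lb \<le> 1" "rho_lb \<le> 1"
    using success_emb success_solv by (meson atLeastAtMost_iff order_trans order_refl)+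
  then have q: "0 < q" "q \<le> 1"
    using \<open>0 < rho_lb\<close> \<open>0 < tau_lb\<close> by (auto simp: q_def mult_le_one)

  have xopt_in: "xopt k w \<in> X" if "k \<ge> 1" "w \<in> space M" for k w
    using xopt[OF that] feasible that by (auto simp: is_arg_min_linorder)
  have xopt_iff: "f (xopt k w) \<le> c \<longleftrightarrow> (\<exists>j\<in>{1..k}. f (?x j w) \<le> c)" if "k \<ge> 1" "w \<in> space M" for k w c
    using xopt[OF that] by (auto simp: is_arg_min_linorder intro: order_trans)
  \<comment> \<open>No measurability of \<open>xopt\<close> is assumed, since ties may be broken
    arbitrarily. Its sublevel sets are events nevertheless, being finite unions of those of the
    iterates.\<close>
  have event_eq: "{w \<in> space M. f (xopt k w) \<le> c} = (\<Union>j\<in>{1..k}. {w \<in> space M. f (?x j w) \<le> c})"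
    if "k \<ge> 1" for k c
    using xopt_iff[OF that] by blast
  have event: "{w \<in> space M. f (xopt k w) \<le> c} \<in> events" if "k \<ge> 1" for k c
    unfolding event_eq[OF that] by (intro sets.finite_UN iterate_sublevel_measurable) auto

  have eq: "?Q k = ?P k" if "k \<ge> 1" for k
    using xopt_in[OF that] by (intro arg_cong[where f = "measure M"]) (auto simp: G_set_def)

  let ?N = "\<lambda>k w. \<Prod>j=1..k. 1 - ?R j w * ?S j w"
  have R01: "0 \<le> ?R k w \<and> ?R k w \<le> 1" and S01: "0 \<le> ?S k w \<and> ?S k w \<le> 1" for k w
    by (simp_all add: R_ind_def S_ind_def)
  have N_le: "expectation (?N k) \<le> (1 - q) ^ k" for k
    unfolding q_def
  proof (rule expectation_prod_failure_le[where F = "Filt (space M) d A y p"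
        and H = "Filt_half (space M) d A y p"])
    \<comment> \<open>The rates may vary with the iteration; only their uniform lower bounds enter
      the geometric estimate.\<close>
    show "AE w in M. rho_lb \<le> real_cond_exp M (Filt_half (space M) d A y p (Suc k)) (?S (Suc k)) w" for k
    proof -
      obtain r where r: "rho_lb \<le> r"
          "AE w in M. r \<le> real_cond_exp M (Filt_half (space M) d A y p (Suc k)) (?S (Suc k)) w"
        using success_solv[rule_format, of "Suc k"] by auto
      from r(2) show ?thesis by eventually_elim (use r(1) in simp)
    qed
    show "AE w in M. tau_lb \<le> real_cond_exp M (Filt (space M) d A y p k) (?R (Suc k)) w" for k
    proof -
      obtain t where t: "tau_lb \<le> t"
          "AE w in M. t \<le> real_cond_exp M (Filt (space M) d A y p k) (?R (Suc k)) w"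
        using success_emb[rule_format, of "Suc k"] by auto
      from t(2) show ?thesis by eventually_elim (use t(1) in simp)
    qed
  qed (use R01 S01 R_measurable[of "Suc _"] S_measurable[of "Suc _"] q \<open>0 < rho_lb\<close> in
      \<open>auto simp: Filt_def Filt_half_def q_def intro!: subalgebra_history subalgebra_history_history\<close>)

  have P_ge: "1 - (1 - q) ^ k \<le> ?P k" if k: "k \<ge> 1" for k
  proof -
    let ?E = "{w \<in> space M. f (xopt k w) \<le> fstar X f + eps}"
    have E: "?E \<in> events" by (rule event[OF k])
    have meas: "?N k \<in> borel_measurable M"
    proof (intro borel_measurable_prod borel_measurable_diff borel_measurable_times borel_measurable_const)
      fix j assume "j \<in> {1..k}"
      then show "?R j \<in> borel_measurable M" "?S j \<in> borel_measurable M"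
        using R_measurable[of j] S_measurable[of j] subalgebra_history
        unfolding Filt_def Filt_half_def by (auto intro: measurable_from_subalg)
    qed
    have N01: "0 \<le> ?N k w" "?N k w \<le> 1" for w
      by (rule prod_one_minus_bounds; use R01 S01 in blast)+
    have "1 - ?P k = prob (space M - ?E)"
      using E by (simp add: prob_compl)
    also have "\<dots> = expectation (indicator (space M - ?E))"
      using E by simp
    \<comment> \<open>Pointwise comparison: \<open>?N k\<close> is nonnegative everywhere and equals
      1 wherever \<open>xopt k\<close> fails.\<close>
    also have "\<dots> \<le> expectation (?N k)"
    proof (rule integral_mono)
      fix w assume w: "w \<in> space M"
      show "indicator (space M - ?E) w \<le> ?N k w"
      proof (cases "w \<in> ?E")
        case False
        then have *: "\<not> f (?x j w) \<le> fstar X f + eps" if "j \<in> {1..k}" for j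
          using xopt_iff[OF k w] w that by blast
        \<comment> \<open>If both indicators were 1, the value at iterate \<open>j\<close> would be
          at most \<open>fmin + lam\<close>, hence at most
          \<open>fstar X f + (eps - lam) + lam\<close>, contradicting \<open>*\<close>.\<close>
        have "?R j w * ?S j w = 0" if "j \<in> {1..k}" for j
          using *[OF that] by (auto simp: R_ind_def S_ind_def)
        then have "?N k w = 1"
          by (intro prod.neutral) simp
        then show ?thesis
          by (simp add: indicator_def)
      qed (use N01 in auto)
    next
      show "integrable M (?N k)"
        by (rule integrable_const_bound[where B = 1]) (use meas N01 in auto)
    next
      have "space M - ?E \<in> events" using E by blast
      then show "integrable M (indicat_real (space M - ?E))"
        by (intro integrable_real_indicator) (simp_all add: less_top[symmetric])
    qed
    finally show ?thesis using N_le[of k] by simp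
  qed

  have lim: "?P \<longlonglongrightarrow> 1"
  proof (rule tendsto_sandwich)
    show "(\<lambda>k. 1 - (1 - q) ^ k) \<longlonglongrightarrow> 1"
      using q LIMSEQ_power_zero[of "1 - q"] by (auto intro!: tendsto_eq_intros)
    show "\<forall>\<^sub>F k in sequentially. 1 - (1 - q) ^ k \<le> ?P k"
      using P_ge by (auto intro: eventually_sequentiallyI)
  qed auto
  \<comment> \<open>The two probabilities are known to agree from \<open>k = 1\<close> on;
    \<open>xopt 0\<close> is unconstrained.\<close>
  moreover have "?Q \<longlonglongrightarrow> 1"
    by (rule Lim_transform_eventually[OF lim]) (auto simp: eq intro: eventually_sequentiallyI[of 1])
  \<comment> \<open>The bound \<open>1 \<le> k\<close> has to be derived along with the estimate, as
    \<open>eq\<close> and \<open>P_ge\<close> require it. It holds because \<open>xi > 0\<close>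
    makes the logarithm nonzero and so \<open>K_xi\<close> positive.\<close>
  moreover have "1 \<le> k \<and> xi \<le> ?P k" if "xi \<in> {0<..<1}" "k \<ge> K_xi tau_lb rho_lb xi" for xi k
  proof -
    have pos: "0 < \<bar>ln (1 - xi)\<bar>" and abs: "\<bar>ln (1 - xi)\<bar> = - ln (1 - xi)"
      using that(1) by auto
    have le: "\<bar>ln (1 - xi)\<bar> / q \<le> real k"
      using that(2) unfolding K_xi_def q_def by linarith
    have k: "k \<ge> 1"
      using le pos q(1) by (cases k) (auto simp: divide_le_0_iff)
    \<comment> \<open>From \<open>1 - q \<le> exp (- q)\<close>, with \<open>q \<le> 1\<close>
      keeping the base nonnegative; this turns the geometric rate into the logarithmic threshold of
      \<open>K_xi\<close>.\<close>
    have "(1 - q) ^ k \<le> exp (- q) ^ k"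
      using q exp_ge_add_one_self[of "- q"] by (intro power_mono) auto
    also have "\<dots> = exp (- (q * real k))"
      by (simp flip: exp_of_nat_mult add: mult.commute)
    also have "\<dots> \<le> exp (ln (1 - xi))"
      using le q(1) abs by (simp add: field_simps)
    also have "\<dots> = 1 - xi"
      using that(1) by simp
    finally show ?thesis
      using P_ge[OF k] k by linarith
  qed
  ultimately show ?thesis
    using eq by auto
qed

end
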